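(* Let $G$ be a non-empty simple graph (i.e. with at least one edge) on $[n]$ with chromatic number $\chi(G)$ and clique number $\omega(G)$. Let $\mathrm{gin}(J_G)$ be the multigraded generic initial ideal of the binomial edge ideal of $G$ and let $I_G$ be the edge ideal of $G$. Then $$\frac{\chi(G)}{\chi(G)-1}\le \widehat{\alpha}(\mathrm{gin}(J_G))=\widehat{\alpha}(I_G)\le\frac{\omega(G)}{\omega(G)-1}.$$
   Context: $\mathbb{K}$ is a field and $S=\mathbb{K}[x_1,\dots,x_n,y_1,\dots,y_n]$. The edge ideal is $I_G=(x_ax_b\mid\{a,b\}\in E(G))$. The binomial edge ideal is $J_G=(x_iy_j-x_jy_i\mid\{i,j\}\in E(G))\subset S$; its multigraded generic initial ideal (for $\deg x_i=\deg y_i=\mathbf{e}_i\in\mathbb{N}^n$) is, by a known theorem (which may be taken here as the definition), the squarefree monomial ideal $\mathrm{gin}(J_G)=(y_{v_1}\cdots y_{v_s}x_ix_j\mid i,v_1,\dots,v_s,j\text{ a path in }G,\ s\ge 0)$, paths having distinct vertices. For a squarefree monomial ideal $I$ with minimal primes $P_1,\dots,P_r$, $I^{(m)}=\bigcap_k P_k^m$; $\alpha(I)$ is the least degree of a nonzero element of $I$, and the Waldschmidt constant is $\widehat{\alpha}(I)=\lim_{m\to\infty}\alpha(I^{(m)})/m$ (the limit exists). *)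

theory Defs
  imports
    Complex_Main
    "HOL-Library.Poly_Mapping"
    "HOL-Algebra.Ideal_Product"
    "HOL-Algebra.Algebraic_Closure_Type"
begin

section \<open>Graphs\<close>

text \<open>
  A graph has the whole (finite) type of vertices as its vertex set, so that a graph on
  \<open>[n]\<close> is an edge set over a finite type with \<open>n\<close> elements.
\<close>

definition simple_graph :: "'v::finite set set \<Rightarrow> bool" where
  "simple_graph E \<longleftrightarrow> (\<forall>e\<in>E. card e = 2)"

definition proper_colouring :: "'v set set \<Rightarrow> ('v \<Rightarrow> nat) \<Rightarrow> bool" where
  "proper_colouring E c \<longleftrightarrow> (\<forall>u v. {u, v} \<in> E \<longrightarrow> c u \<noteq> c v)"

definition chromatic_number :: "'v::finite set set \<Rightarrow> nat" where
  "chromatic_number E = (LEAST k. \<exists>c. (\<forall>v. c v < k) \<and> proper_colouring E c)"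

definition clique :: "'v set set \<Rightarrow> 'v set \<Rightarrow> bool" where
  "clique E C \<longleftrightarrow> (\<forall>u\<in>C. \<forall>v\<in>C. u \<noteq> v \<longrightarrow> {u, v} \<in> E)"

definition clique_number :: "'v::finite set set \<Rightarrow> nat" where
  "clique_number E = Max {card C | C. clique E C}"

definition graph_path :: "'v set set \<Rightarrow> 'v list \<Rightarrow> bool" where
  "graph_path E p \<longleftrightarrow> distinct p \<and> successively (\<lambda>u v. {u, v} \<in> E) p"


section \<open>Polynomials\<close>

text \<open>Polynomials are finitely supported maps from monomials (exponent vectors) to coefficients.\<close>

type_synonym ('x, 'k) mpoly = "('x \<Rightarrow>\<^sub>0 nat) \<Rightarrow>\<^sub>0 'k"

abbreviation mpoly_ring :: "('x, 'k::field) mpoly ring" where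
  "mpoly_ring \<equiv> ring_of_type_algebra"

definition mvar :: "'x \<Rightarrow> ('x, 'k::field) mpoly" where
  "mvar x = Poly_Mapping.single (Poly_Mapping.single x 1) 1"

definition monom_degree :: "('x \<Rightarrow>\<^sub>0 nat) \<Rightarrow> nat" where
  "monom_degree m = (\<Sum>x\<in>Poly_Mapping.keys m. Poly_Mapping.lookup m x)"

text \<open>The value at the zero polynomial is irrelevant.\<close>

definition total_degree :: "('x, 'k::field) mpoly \<Rightarrow> nat" where
  "total_degree f = Max (monom_degree ` Poly_Mapping.keys f)"


section \<open>Symbolic powers and the Waldschmidt constant\<close>

definition minimal_primes :: "('a, 'b) ring_scheme \<Rightarrow> 'a set \<Rightarrow> 'a set set" where
  "minimal_primes R I =
    {P. primeideal P R \<and> I \<subseteq> P \<and> (\<forall>Q. primeideal Q R \<and> I \<subseteq> Q \<and> Q \<subseteq> P \<longrightarrow> Q = P)}"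

text \<open>
  This is the symbolic power of a squarefree monomial ideal (more generally, of a radical ideal)
  of a polynomial ring. The power \<open>P [^] m\<close> is taken in the monoid of ideals.
\<close>

definition symbolic_power :: "('x, 'k::field) mpoly set \<Rightarrow> nat \<Rightarrow> ('x, 'k) mpoly set" where
  "symbolic_power I m = (\<Inter>P\<in>minimal_primes mpoly_ring I. P [^]\<^bsub>ideals_set mpoly_ring\<^esub> m)"

definition initial_degree :: "('x, 'k::field) mpoly set \<Rightarrow> nat" where
  "initial_degree I = (LEAST d. \<exists>f\<in>I. f \<noteq> 0 \<and> total_degree f = d)"

definition waldschmidt :: "('x, 'k::field) mpoly set \<Rightarrow> real" where
  "waldschmidt I = lim (\<lambda>m. real (initial_degree (symbolic_power I m)) / real m)"


section \<open>Edge ideals and generic initial ideals of binomial edge ideals\<close>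

datatype 'v xy = XVar 'v | YVar 'v

definition edge_ideal :: "'v::finite set set \<Rightarrow> ('v xy, 'k::field) mpoly set" where
  "edge_ideal E = genideal mpoly_ring {mvar (XVar a) * mvar (XVar b) | a b. {a, b} \<in> E}"

text \<open>
  The multigraded generic initial ideal of the binomial edge ideal
  \<open>(x\<^sub>i y\<^sub>j - x\<^sub>j y\<^sub>i | {i, j} \<in> E)\<close>, given by its known monomial generators:
  one for each path in the graph, with the \<open>YVar\<close> variables of the inner vertices.
\<close>

definition gin_binomial_edge_ideal :: "'v::finite set set \<Rightarrow> ('v xy, 'k::field) mpoly set" where
  "gin_binomial_edge_ideal E = genideal mpoly_ring
    {(\<Prod>v\<leftarrow>vs. mvar (YVar v)) * mvar (XVar i) * mvar (XVar j) | i vs j. graph_path E (i # vs @ [j])}"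

end

theory Submission
  imports Defs
begin

text \<open>
  The minimal primes of a monomial ideal are generated by the variables of its minimal covers,
  so a monomial with exponent vector \<open>w\<close> lies in the \<open>m\<close>-th symbolic power iff \<open>w\<close> has weight
  at least \<open>m\<close> on every cover, and the initial degree is the least total weight of such a \<open>w\<close>.
  Moving the weight of \<open>YVar v\<close> onto \<open>XVar v\<close> turns a solution for the paths into one for the
  edges of the same total weight, because a vertex cover of the graph, taken in both sets of
  variables, meets every path. Hence already the initial degrees of all symbolic powers of the
  two ideals agree. The complements of the colour classes of an optimal colouring are covers,
  which gives the lower bound; constant weight on a maximum clique gives the upper bound.
\<close>

section \<open>Subadditive sequences\<close>

lemma subadditive_mult_le:
  fixes a :: "nat \<Rightarrow> real"
  assumes "\<And>m n. a (m + n) \<le> a m + a n" "a 0 = 0"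
  shows "a (q * k) \<le> real q * a k"
proof (induction q)
  case (Suc q)
  have "a (Suc q * k) \<le> a k + a (q * k)"
    using assms(1)[of k "q * k"] by simp
  then show ?case using Suc by (simp add: algebra_simps)
qed (simp add: assms)

text \<open>Fekete's lemma: the limit is the infimum \<open>L\<close> of the quotients. With
  \<open>a k / k\<close> close to \<open>L\<close>, division of \<open>n\<close> by \<open>k\<close>
  with remainder bounds \<open>a n\<close> by \<open>n * (a k / k)\<close> plus a constant, and the
  constant vanishes after division by \<open>n\<close>.\<close>

lemma subadditive_div_convergent:
  fixes a :: "nat \<Rightarrow> real"
  assumes sub: "\<And>m n. a (m + n) \<le> a m + a n" and zero: "a 0 = 0" and nonneg: "\<And>n. a n \<ge> 0"
  shows "convergent (\<lambda>n. a n / real n)"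
proof -
  define L where "L = (INF n\<in>{1..}. a n / real n)"
  have bdd: "bdd_below ((\<lambda>n. a n / real n) ` {1..})"
    using nonneg by (intro bdd_belowI[of _ 0]) auto
  have "(\<lambda>n. a n / real n) \<longlonglongrightarrow> L"
  proof (rule LIMSEQ_I)
    fix e :: real assume "e > 0"
    have "L < L + e / 2" using \<open>e > 0\<close> by simp
    then obtain k where k: "k \<ge> 1" "a k / real k < L + e / 2"
      unfolding L_def using cInf_lessD[of "(\<lambda>n. a n / real n) ` {1..}" "L + e / 2"]
      by (auto simp: L_def)
    \<comment> \<open>\<open>M\<close> dominates \<open>a (n mod k)\<close> for every
      \<open>n\<close>, because all terms are nonnegative.\<close>
    define M where "M = (\<Sum>r<k. a r)"
    obtain N where N: "real N > 2 * M / e" using reals_Archimedean2 by blast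
    have "norm (a n / real n - L) < e" if n: "n \<ge> max 1 N" for n
    proof -
      have "n > 0" using n by simp
      have lower: "L \<le> a n / real n"
        unfolding L_def using n by (intro cINF_lower[OF bdd]) auto
      have "a n = a ((n div k) * k + n mod k)" by simp
      also have "\<dots> \<le> a ((n div k) * k) + a (n mod k)" by (rule sub)
      also have "\<dots> \<le> real (n div k) * a k + M"
        unfolding M_def using k nonneg
        by (intro add_mono subadditive_mult_le sub zero member_le_sum) auto
      also have "real (n div k) * a k \<le> real n / real k * a k"
        by (intro mult_right_mono nonneg) (rule of_nat_div_le_of_nat)
      finally have "a n \<le> real n * (a k / real k) + M" by simp
      then have "a n / real n \<le> a k / real k + M / real n"
        using \<open>n > 0\<close> by (simp add: field_simps)
      moreover have "M / real n < e / 2"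
      proof -
        have "2 * M / e < real n" using N n by linarith
        then show ?thesis using \<open>e > 0\<close> \<open>n > 0\<close> by (simp add: field_simps)
      qed
      ultimately show ?thesis using lower k(2) unfolding real_norm_def by linarith
    qed
    then show "\<exists>N. \<forall>n\<ge>N. norm (a n / real n - L) < e" by blast
  qed
  then show ?thesis by (rule convergentI)
qed


section \<open>Weight ideals\<close>

abbreviation monom_weight :: "'x set \<Rightarrow> ('x \<Rightarrow>\<^sub>0 nat) \<Rightarrow> nat" where
  "monom_weight C w \<equiv> sum (Poly_Mapping.lookup w) C"

definition weight_ideal :: "'x set \<Rightarrow> nat \<Rightarrow> ('x, 'k::field) mpoly set" where
  "weight_ideal C m = {f. \<forall>w\<in>Poly_Mapping.keys f. m \<le> monom_weight C w}"

lemma monom_weight_add: "monom_weight C (v + w) = monom_weight C v + monom_weight C w"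
  by (simp add: lookup_add sum.distrib)

lemma poly_mapping_sum_single:
  "f = (\<Sum>w\<in>Poly_Mapping.keys f. Poly_Mapping.single w (Poly_Mapping.lookup f w))"
  by (rule poly_mapping_eqI)
    (simp add: lookup_sum lookup_single when_def in_keys_iff)

section \<open>Ideals in terms of the arithmetic of the type\<close>

text \<open>Closure under negation follows from multiplication by \<open>-1\<close>. Together with
  the converse below, this replaces the record operations of \<open>ring_of_type_algebra\<close> by
  those of the type class.\<close>

lemma ideal_ring_of_type_algebraI:
  fixes I :: "'a::comm_ring_1 set"
  assumes "0 \<in> I" "\<And>a b. a \<in> I \<Longrightarrow> b \<in> I \<Longrightarrow> a + b \<in> I" "\<And>a b. a \<in> I \<Longrightarrow> b * a \<in> I"
  shows "ideal I ring_of_type_algebra"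
proof -
  interpret cring "ring_of_type_algebra :: 'a ring" by (rule cring_from_type_algebra)
  have minus: "\<ominus>\<^bsub>ring_of_type_algebra\<^esub> a = - a" for a :: 'a
    by (rule minus_equality) (simp_all add: ring_of_type_algebra_def)
  have "- a \<in> I" if "a \<in> I" for a
    using assms(3)[OF that, of "-1"] by simp
  then have "subgroup I (add_monoid ring_of_type_algebra)"
    using assms minus
    by (intro add.subgroupI) (auto simp: ring_of_type_algebra_def a_inv_def)
  then show ?thesis
    using assms by (intro idealI ring_axioms) (auto simp: ring_of_type_algebra_def mult.commute)
qed

lemma ideal_ring_of_type_algebraD:
  fixes I :: "'a::comm_ring_1 set"
  assumes "ideal I ring_of_type_algebra"
  shows "0 \<in> I" "\<And>a b. a \<in> I \<Longrightarrow> b \<in> I \<Longrightarrow> a + b \<in> I" "\<And>a b. a \<in> I \<Longrightarrow> b * a \<in> I"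
proof -
  interpret ideal I ring_of_type_algebra by fact
  show "0 \<in> I" "\<And>a b. a \<in> I \<Longrightarrow> b \<in> I \<Longrightarrow> a + b \<in> I" "\<And>a b. a \<in> I \<Longrightarrow> b * a \<in> I"
    using additive_subgroup.zero_closed[OF additive_subgroup_axioms]
      additive_subgroup.a_closed[OF additive_subgroup_axioms] I_l_closed
    by (auto simp: ring_of_type_algebra_def)
qed

lemma ideal_ring_of_type_algebra_sum:
  fixes I :: "'a::comm_ring_1 set"
  assumes "ideal I ring_of_type_algebra" "\<And>x. x \<in> A \<Longrightarrow> g x \<in> I"
  shows "sum g A \<in> I"
  using assms(2)
  by (induction A rule: infinite_finite_induct)
    (auto intro: ideal_ring_of_type_algebraD[OF assms(1)])

lemma weight_ideal_mult:
  assumes "f \<in> weight_ideal C m" "g \<in> weight_ideal C n"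
  shows "f * g \<in> weight_ideal C (m + n)"
  using assms keys_mult[of f g]
  by (fastforce simp: weight_ideal_def monom_weight_add intro: add_mono)

lemma ideal_weight_ideal: "ideal (weight_ideal C m) (mpoly_ring :: ('x, 'k::field) mpoly ring)"
proof (rule ideal_ring_of_type_algebraI)
  fix a b :: "('x, 'k) mpoly"
  assume a: "a \<in> weight_ideal C m"
  show "a + b \<in> weight_ideal C m" if "b \<in> weight_ideal C m"
    using a that keys_add[of a b] by (auto simp: weight_ideal_def)
  show "b * a \<in> weight_ideal C m"
    using weight_ideal_mult[of b C 0 a m] a by (simp add: weight_ideal_def)
qed (simp add: weight_ideal_def)

section \<open>Powers of ideals generated by variables\<close>

text \<open>The truncated subtraction of exponent vectors is exact here, because the exponent of
  \<open>x\<close> is positive.\<close>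

lemma single_divide_mvar:
  fixes c :: "'k::field"
  assumes "Poly_Mapping.lookup w x > 0"
  shows "Poly_Mapping.single w c = mvar x * Poly_Mapping.single (w - Poly_Mapping.single x 1) c"
proof -
  have "Poly_Mapping.single x 1 + (w - Poly_Mapping.single x 1) = w"
    using assms by (intro poly_mapping_eqI) (auto simp: lookup_add lookup_minus lookup_single when_def)
  then show ?thesis by (simp add: mvar_def mult_single)
qed

lemma mvar_in_weight_ideal:
  fixes C :: "'x::finite set"
  shows "(mvar x :: ('x, 'k::field) mpoly) \<in> weight_ideal C 1 \<longleftrightarrow> x \<in> C"
  by (auto simp: weight_ideal_def mvar_def lookup_single when_def)

text \<open>Each term of a member contains some variable of \<open>C\<close>, hence is a multiple of
  an element of \<open>Q\<close>. So \<open>weight_ideal C 1\<close> is the ideal generated by the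
  variables in \<open>C\<close>.\<close>

lemma weight_ideal_1_subset:
  assumes "ideal Q (mpoly_ring :: ('x, 'k::field) mpoly ring)" "\<And>x. x \<in> C \<Longrightarrow> mvar x \<in> Q"
  shows "weight_ideal C 1 \<subseteq> Q"
proof
  fix f :: "('x, 'k) mpoly" assume f: "f \<in> weight_ideal C 1"
  have "Poly_Mapping.single w (Poly_Mapping.lookup f w) \<in> Q" if "w \<in> Poly_Mapping.keys f" for w
  proof -
    have "monom_weight C w \<noteq> 0" using f that by (fastforce simp: weight_ideal_def)
    then obtain x where x: "x \<in> C" "Poly_Mapping.lookup w x > 0"
      by (metis gr_zeroI sum.not_neutral_contains_not_neutral)
    show ?thesis
      unfolding single_divide_mvar[OF x(2)] mult.commute[of "mvar x"]
      by (rule ideal_ring_of_type_algebraD(3)[OF assms(1) assms(2)[OF x(1)]])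
  qed
  then show "f \<in> Q"
    by (subst poly_mapping_sum_single) (rule ideal_ring_of_type_algebra_sum[OF assms(1)])
qed

text \<open>A product of two factors adds their weights; conversely, one variable of
  \<open>C\<close> can be split off every term of weight at least \<open>Suc m\<close>.\<close>

lemma weight_ideal_power:
  fixes C :: "'x::finite set"
  shows "weight_ideal C 1 [^]\<^bsub>ideals_set mpoly_ring\<^esub> m
    = (weight_ideal C m :: ('x, 'k::field) mpoly set)"
proof (induction m)
  case 0
  \<comment> \<open>The unit of the monoid of ideals is the whole ring, and the weight bound 0 is
    vacuous.\<close>
  show ?case by (simp add: ideals_set_def ring_of_type_algebra_def weight_ideal_def)
next
  case (Suc m)
  let ?R = "mpoly_ring :: ('x, 'k) mpoly ring"
  let ?W = "\<lambda>m. weight_ideal C m :: ('x, 'k) mpoly set"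
  interpret cring ?R by (rule cring_from_type_algebra)
  have "ideal_prod ?R (?W m) (?W 1) = ?W (Suc m)"
  proof
    show "ideal_prod ?R (?W m) (?W 1) \<subseteq> ?W (Suc m)"
    proof
      fix f assume "f \<in> ideal_prod ?R (?W m) (?W 1)"
      then show "f \<in> ?W (Suc m)"
      proof induction
        case (prod i j)
        then show ?case
          using weight_ideal_mult[of i C m j 1] by (simp add: ring_of_type_algebra_def)
      next
        case (sum f g)
        then show ?case
          using ideal_ring_of_type_algebraD(2)[OF ideal_weight_ideal]
          by (simp add: ring_of_type_algebra_def)
      qed
    qed
    have id: "ideal (ideal_prod ?R (?W m) (?W 1)) ?R"
      by (intro ideal_prod_is_ideal ideal_weight_ideal)
    show "?W (Suc m) \<subseteq> ideal_prod ?R (?W m) (?W 1)"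
    proof
      fix f :: "('x, 'k) mpoly" assume f: "f \<in> ?W (Suc m)"
      have "Poly_Mapping.single w (Poly_Mapping.lookup f w) \<in> ideal_prod ?R (?W m) (?W 1)"
        if "w \<in> Poly_Mapping.keys f" for w
      proof -
        let ?c = "Poly_Mapping.lookup f w"
        have w: "Suc m \<le> monom_weight C w" using f that by (auto simp: weight_ideal_def)
        then obtain x where x: "x \<in> C" "Poly_Mapping.lookup w x > 0"
          by (metis Suc_n_not_le_n gr_zeroI le_zero_eq nat.distinct(1) sum.not_neutral_contains_not_neutral)
        let ?v = "w - Poly_Mapping.single x 1"
        have "w = Poly_Mapping.single x 1 + ?v"
          using x by (intro poly_mapping_eqI) (auto simp: lookup_add lookup_minus lookup_single when_def)
        then have "monom_weight C w = monom_weight C (Poly_Mapping.single x 1) + monom_weight C ?v"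
          using monom_weight_add[of "Poly_Mapping.single x 1" ?v C] by metis
        moreover have "monom_weight C (Poly_Mapping.single x (1::nat)) = 1"
          using x by (simp add: lookup_single when_def)
        ultimately have "m \<le> monom_weight C ?v" using w by simp
        then have "Poly_Mapping.single ?v ?c \<in> ?W m" by (simp add: weight_ideal_def)
        then show ?thesis
          unfolding single_divide_mvar[OF x(2)]
          using ideal_prod.prod[of _ "?W m" "mvar x" "?W 1" ?R] mvar_in_weight_ideal[of x C] x(1)
          unfolding mult.commute[of "mvar x"]
          by (simp add: ring_of_type_algebra_def)
      qed
      then show "f \<in> ideal_prod ?R (?W m) (?W 1)"
        by (subst poly_mapping_sum_single) (rule ideal_ring_of_type_algebra_sum[OF id])
    qed
  qed
  then show ?case using Suc by (simp add: ideals_set_def)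
qed

section \<open>Primality of ideals generated by variables\<close>

text \<open>
  Maximizing one coordinate after the other shrinks both sets to single elements, whose sum has
  no other representation.
\<close>

lemma unique_sum_on:
  fixes A B :: "('x \<Rightarrow>\<^sub>0 nat) set"
  assumes "finite S" "finite A" "finite B" "A \<noteq> {}" "B \<noteq> {}"
  shows "\<exists>A' B'. A' \<subseteq> A \<and> B' \<subseteq> B \<and> A' \<noteq> {} \<and> B' \<noteq> {}
    \<and> (\<forall>a\<in>A'. \<forall>b\<in>B'. \<forall>c\<in>A. \<forall>d\<in>B. c + d = a + b \<longrightarrow> c \<in> A' \<and> d \<in> B')
    \<and> (\<forall>x\<in>S. \<forall>a\<in>A'. \<forall>c\<in>A'. Poly_Mapping.lookup a x = Poly_Mapping.lookup c x)
    \<and> (\<forall>x\<in>S. \<forall>b\<in>B'. \<forall>d\<in>B'. Poly_Mapping.lookup b x = Poly_Mapping.lookup d x)"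
    (is "\<exists>A' B'. ?P S A' B'")
  using assms(1)
proof (induction S)
  case empty
  show ?case by (rule exI[of _ A], rule exI[of _ B]) (use assms in auto)
next
  case (insert x S)
  then obtain A' B' where "?P S A' B'" by (elim exE) (rule that)
  then have IH: "A' \<subseteq> A" "B' \<subseteq> B" "A' \<noteq> {}" "B' \<noteq> {}"
    "\<forall>a\<in>A'. \<forall>b\<in>B'. \<forall>c\<in>A. \<forall>d\<in>B. c + d = a + b \<longrightarrow> c \<in> A' \<and> d \<in> B'"
    "\<forall>x\<in>S. \<forall>a\<in>A'. \<forall>c\<in>A'. Poly_Mapping.lookup a x = Poly_Mapping.lookup c x"
    "\<forall>x\<in>S. \<forall>b\<in>B'. \<forall>d\<in>B'. Poly_Mapping.lookup b x = Poly_Mapping.lookup d x"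
    by - (elim conjE, assumption)+
  let ?l = "\<lambda>a. Poly_Mapping.lookup a x"
  define M where "M = Max (?l ` A')"
  define N where "N = Max (?l ` B')"
  have fin: "finite A'" "finite B'" using IH(1,2) assms finite_subset by blast+
  have M: "?l a \<le> M" if "a \<in> A'" for a
    unfolding M_def using fin that by (intro Max_ge) auto
  have M_attained: "M \<in> ?l ` A'"
    unfolding M_def using fin IH(3) by (intro Max_in) auto
  have N: "?l a \<le> N" if "a \<in> B'" for a
    unfolding N_def using fin that by (intro Max_ge) auto
  have N_attained: "N \<in> ?l ` B'"
    unfolding N_def using fin IH(4) by (intro Max_in) auto
  define A'' where "A'' = {a\<in>A'. ?l a = M}"
  define B'' where "B'' = {b\<in>B'. ?l b = N}"
  have closed: "c \<in> A'' \<and> d \<in> B''"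
    if "a \<in> A''" "b \<in> B''" "c \<in> A" "d \<in> B" "c + d = a + b" for a b c d
  proof -
    have "c \<in> A'" "d \<in> B'" using IH(5) that unfolding A''_def B''_def by blast+
    \<comment> \<open>Neither summand can exceed its maximum, so the total \<open>M + N\<close>
      forces both to be maximal.\<close>
    moreover have "?l c + ?l d = M + N"
      using that by (metis (mono_tags, lifting) A''_def B''_def lookup_add mem_Collect_eq)
    ultimately show ?thesis
      using M[of c] N[of d] by (simp add: A''_def B''_def)
  qed
  have ne: "A'' \<noteq> {}" "B'' \<noteq> {}" using M_attained N_attained by (auto simp: A''_def B''_def)
  have "A'' \<subseteq> A'" "B'' \<subseteq> B'" by (auto simp: A''_def B''_def)
  show ?case
  proof (rule exI[of _ A''], rule exI[of _ B''], intro conjI)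
    show "\<forall>y\<in>insert x S. \<forall>a\<in>A''. \<forall>c\<in>A''. Poly_Mapping.lookup a y = Poly_Mapping.lookup c y"
      using IH(6) by (auto simp: A''_def)
    show "\<forall>y\<in>insert x S. \<forall>a\<in>B''. \<forall>c\<in>B''. Poly_Mapping.lookup a y = Poly_Mapping.lookup c y"
      using IH(7) by (auto simp: B''_def)
  qed (use closed ne IH(1,2) \<open>A'' \<subseteq> A'\<close> \<open>B'' \<subseteq> B'\<close> in blast)+
qed

text \<open>Once all coordinates are fixed, the two subsets are singletons. The pair
  \<open>a\<close>, \<open>b\<close> plays the role of the leading monomials of two polynomials,
  without the choice of a monomial order.\<close>

lemma unique_sum:
  fixes A B :: "('x::finite \<Rightarrow>\<^sub>0 nat) set"
  assumes "finite A" "finite B" "A \<noteq> {}" "B \<noteq> {}"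
  obtains a b where "a \<in> A" "b \<in> B"
    "\<And>c d. \<lbrakk>c \<in> A; d \<in> B; c + d = a + b\<rbrakk> \<Longrightarrow> c = a \<and> d = b"
proof -
  obtain A' B' where *: "A' \<subseteq> A" "B' \<subseteq> B" "A' \<noteq> {}" "B' \<noteq> {}"
    "\<forall>a\<in>A'. \<forall>b\<in>B'. \<forall>c\<in>A. \<forall>d\<in>B. c + d = a + b \<longrightarrow> c \<in> A' \<and> d \<in> B'"
    "\<forall>x\<in>UNIV. \<forall>a\<in>A'. \<forall>c\<in>A'. Poly_Mapping.lookup a x = Poly_Mapping.lookup c x"
    "\<forall>x\<in>UNIV. \<forall>b\<in>B'. \<forall>d\<in>B'. Poly_Mapping.lookup b x = Poly_Mapping.lookup d x"
    using unique_sum_on[OF finite[of UNIV] assms] by blast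
  then obtain a b where "a \<in> A'" "b \<in> B'" by blast
  moreover have "c = a" if "c \<in> A'" for c
    using *(6) that \<open>a \<in> A'\<close> by (intro poly_mapping_eqI) blast
  moreover have "d = b" if "d \<in> B'" for d
    using *(7) that \<open>b \<in> B'\<close> by (intro poly_mapping_eqI) blast
  ultimately show thesis using * by (intro that[of a b]) blast+
qed

text \<open>In the convolution formula for the coefficient at \<open>a + b\<close>, every pair other
  than \<open>(a, b)\<close> contributes zero.\<close>

lemma lookup_mult_unique:
  fixes f g :: "'a::monoid_add \<Rightarrow>\<^sub>0 'b::semiring_0"
  assumes "\<And>c d. \<lbrakk>c \<in> Poly_Mapping.keys f; d \<in> Poly_Mapping.keys g; c + d = a + b\<rbrakk>
    \<Longrightarrow> c = a \<and> d = b"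
  shows "Poly_Mapping.lookup (f * g) (a + b) = Poly_Mapping.lookup f a * Poly_Mapping.lookup g b"
proof -
  have "Poly_Mapping.lookup (f * g) (a + b)
    = (\<Sum>(c, d). Poly_Mapping.lookup f c * Poly_Mapping.lookup g d when a + b = c + d)"
    by (simp add: times_poly_mapping.rep_eq prod_fun_unfold_prod)
  also have "\<dots> = (\<Sum>p. Poly_Mapping.lookup f a * Poly_Mapping.lookup g b when p = (a, b))"
  proof (rule Sum_any.cong)
    fix p :: "'a \<times> 'a"
    obtain c d where p: "p = (c, d)" by (cases p)
    show "(case p of (c, d) \<Rightarrow> Poly_Mapping.lookup f c * Poly_Mapping.lookup g d when a + b = c + d)
      = (Poly_Mapping.lookup f a * Poly_Mapping.lookup g b when p = (a, b))"
      using assms[of c d] by (cases "Poly_Mapping.lookup f c = 0"; cases "Poly_Mapping.lookup g d = 0")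
        (auto simp: p when_def in_keys_iff)
  qed
  finally show ?thesis by simp
qed

text \<open>Only the terms free of variables in \<open>C\<close> matter modulo the ideal. If
  \<open>f\<close> and \<open>g\<close> both have such terms, a uniquely represented sum of their
  exponents gives a term of \<open>f * g\<close> that is again free of \<open>C\<close>.\<close>

lemma primeideal_weight_ideal:
  fixes C :: "'x::finite set"
  shows "primeideal (weight_ideal C 1) (mpoly_ring :: ('x, 'k::field) mpoly ring)"
proof (rule primeidealI)
  show "cring (mpoly_ring :: ('x, 'k) mpoly ring)" by (rule cring_from_type_algebra)
  have "(1 :: ('x, 'k) mpoly) \<notin> weight_ideal C 1" by (simp add: weight_ideal_def)
  then show "carrier (mpoly_ring :: ('x, 'k) mpoly ring) \<noteq> weight_ideal C 1"
    by (auto simp: ring_of_type_algebra_def)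
  fix f g :: "('x, 'k) mpoly"
  assume fg: "f \<otimes>\<^bsub>mpoly_ring\<^esub> g \<in> weight_ideal C 1"
  show "f \<in> weight_ideal C 1 \<or> g \<in> weight_ideal C 1"
  proof (rule ccontr)
    assume neg: "\<not> ?thesis"
    define A where "A = {w \<in> Poly_Mapping.keys f. monom_weight C w = 0}"
    define B where "B = {w \<in> Poly_Mapping.keys g. monom_weight C w = 0}"
    have "A \<noteq> {}" "B \<noteq> {}"
      using neg by (auto simp: A_def B_def weight_ideal_def not_le)
    then obtain a b where ab: "a \<in> A" "b \<in> B"
      and uniq: "\<And>c d. \<lbrakk>c \<in> A; d \<in> B; c + d = a + b\<rbrakk> \<Longrightarrow> c = a \<and> d = b"
      using unique_sum[of A B] finite_keys
      by (metis (no_types, lifting) A_def B_def finite_subset mem_Collect_eq subsetI)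
    have ab0: "monom_weight C (a + b) = 0"
      using ab unfolding monom_weight_add by (simp add: A_def B_def)
    have "Poly_Mapping.lookup (f * g) (a + b) = Poly_Mapping.lookup f a * Poly_Mapping.lookup g b"
    \<comment> \<open>Weights are nonnegative and add up, so any two exponents with sum
      \<open>a + b\<close> have weight zero and lie in \<open>A\<close> and
      \<open>B\<close>.\<close>
    proof (rule lookup_mult_unique)
      fix c d assume cd: "c \<in> Poly_Mapping.keys f" "d \<in> Poly_Mapping.keys g" "c + d = a + b"
      then have "monom_weight C c + monom_weight C d = 0"
        using ab0 monom_weight_add[of c d C] by simp
      then have "c \<in> A" "d \<in> B" using cd by (simp_all add: A_def B_def)
      then show "c = a \<and> d = b" using cd(3) by (rule uniq)
    qed
    also have "\<dots> \<noteq> 0" using ab by (auto simp: A_def B_def in_keys_iff)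
    finally have "a + b \<in> Poly_Mapping.keys (f * g)" by (simp add: in_keys_iff)
    moreover have "f * g \<in> weight_ideal C 1"
      using fg by (simp add: ring_of_type_algebra_def)
    ultimately show False using ab0 by (auto simp: weight_ideal_def)
  qed
qed (rule ideal_weight_ideal)


section \<open>Symbolic powers of monomial ideals\<close>

text \<open>A generating monomial is given by the list of its variables.\<close>

definition monomial_ideal :: "'x list set \<Rightarrow> ('x, 'k::field) mpoly set" where
  "monomial_ideal H = genideal mpoly_ring ((\<lambda>xs. \<Prod>x\<leftarrow>xs. mvar x) ` H)"

text \<open>These are the hitting sets of the hypergraph formed by the variable sets of the
  generators.\<close>

definition covers :: "'x list set \<Rightarrow> 'x set \<Rightarrow> bool" where
  "covers H C \<longleftrightarrow> (\<forall>xs\<in>H. set xs \<inter> C \<noteq> {})"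

lemma prod_list_in_primeideal:
  fixes P :: "'a::comm_ring_1 set"
  assumes "primeideal P ring_of_type_algebra"
  shows "prod_list ys \<in> P \<longleftrightarrow> (\<exists>y\<in>set ys. y \<in> P)"
proof -
  interpret primeideal P "ring_of_type_algebra :: 'a ring" by fact
  note D = ideal_ring_of_type_algebraD[OF is_ideal]
  have "1 \<notin> P"
    using D(3)[of 1] I_notcarr by (auto simp: ring_of_type_algebra_def)
  moreover have "a * b \<in> P \<longleftrightarrow> a \<in> P \<or> b \<in> P" for a b
    using I_prime[of a b] D(3)[of a b] D(3)[of b a]
    by (auto simp: ring_of_type_algebra_def mult.commute)
  ultimately show ?thesis by (induction ys) auto
qed

text \<open>A prime contains a monomial exactly when it contains one of its variables, so containing
  all generators is a covering condition.\<close>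

lemma monomial_ideal_subset_iff:
  fixes P :: "('x, 'k::field) mpoly set"
  assumes "primeideal P mpoly_ring"
  shows "monomial_ideal H \<subseteq> P \<longleftrightarrow> covers H {x. mvar x \<in> P}"
proof -
  interpret primeideal P "mpoly_ring :: ('x, 'k) mpoly ring" by fact
  have "monomial_ideal H \<subseteq> P \<longleftrightarrow> (\<lambda>xs. \<Prod>x\<leftarrow>xs. mvar x) ` H \<subseteq> P"
    unfolding monomial_ideal_def
    by (intro Idl_subset_ideal is_ideal) (simp add: ring_of_type_algebra_def)
  also have "\<dots> \<longleftrightarrow> covers H {x. mvar x \<in> P}"
    unfolding image_subset_iff prod_list_in_primeideal[OF assms] covers_def
    by (intro ball_cong) auto
  finally show ?thesis .
qed

lemma weight_ideal_1_subset_iff: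
  fixes C D :: "'x::finite set"
  shows "weight_ideal C 1 \<subseteq> (weight_ideal D 1 :: ('x, 'k::field) mpoly set) \<longleftrightarrow> C \<subseteq> D"
proof
  assume "weight_ideal C 1 \<subseteq> (weight_ideal D 1 :: ('x, 'k::field) mpoly set)"
  then show "C \<subseteq> D" using mvar_in_weight_ideal by blast
next
  assume "C \<subseteq> D"
  then show "weight_ideal C 1 \<subseteq> (weight_ideal D 1 :: ('x, 'k::field) mpoly set)"
    by (intro weight_ideal_1_subset ideal_weight_ideal) (auto simp only: mvar_in_weight_ideal)
qed

text \<open>The variables in a prime \<open>P\<close> above the ideal form a cover, and the prime
  they generate lies between the ideal and \<open>P\<close>. Minimal primes are thus generated by
  variables, and inclusion of such primes is inclusion of covers.\<close>

lemma minimal_primes_monomial_ideal: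
  fixes H :: "'x::finite list set"
  shows "minimal_primes mpoly_ring (monomial_ideal H :: ('x, 'k::field) mpoly set)
    = {weight_ideal C 1 | C. covers H C \<and> (\<forall>D. covers H D \<longrightarrow> D \<subseteq> C \<longrightarrow> D = C)}"
    (is "?L = ?R")
proof -
  let ?I = "monomial_ideal H :: ('x, 'k) mpoly set"
  let ?W = "\<lambda>C. weight_ideal C 1 :: ('x, 'k) mpoly set"
  have W_iff: "?I \<subseteq> ?W C \<longleftrightarrow> covers H C" for C
    using monomial_ideal_subset_iff[OF primeideal_weight_ideal, of H C]
    by (simp only: mvar_in_weight_ideal Collect_mem_eq)
  have below: "covers H {x. mvar x \<in> P}" "?W {x. mvar x \<in> P} \<subseteq> P"
    if "primeideal P mpoly_ring" "?I \<subseteq> P" for P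
  proof -
    show "covers H {x. mvar x \<in> P}" using that monomial_ideal_subset_iff by blast
    show "?W {x. mvar x \<in> P} \<subseteq> P"
      using primeideal.axioms(1)[OF that(1)] by (rule weight_ideal_1_subset) simp
  qed
  show ?thesis
  proof (intro equalityI subsetI)
    fix P assume "P \<in> ?L"
    then have P: "primeideal P mpoly_ring" "?I \<subseteq> P"
      and min: "\<And>Q. primeideal Q mpoly_ring \<Longrightarrow> ?I \<subseteq> Q \<Longrightarrow> Q \<subseteq> P \<Longrightarrow> Q = P"
      by (auto simp: minimal_primes_def)
    let ?C = "{x. mvar x \<in> P}"
    \<comment> \<open>Taking \<open>D\<close> to be \<open>?C\<close> shows that \<open>P\<close> is
      generated by its variables; the other choices of \<open>D\<close> give minimality of
      \<open>?C\<close>.\<close>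
    have eq: "?W D = P" if "covers H D" "D \<subseteq> ?C" for D
      using that below[OF P] weight_ideal_1_subset_iff[of D ?C, where 'k = 'k]
      by (intro min primeideal_weight_ideal) (auto simp only: W_iff)
    have "D = ?C" if "covers H D" "D \<subseteq> ?C" for D
      using eq[OF that] eq[of ?C] below(1)[OF P] that weight_ideal_1_subset_iff[of ?C D, where 'k = 'k]
      by auto
    then show "P \<in> ?R"
      using eq[of ?C] below(1)[OF P] by blast
  next
    fix P assume "P \<in> ?R"
    then obtain C where C: "P = ?W C" "covers H C"
      and min: "\<And>D. covers H D \<Longrightarrow> D \<subseteq> C \<Longrightarrow> D = C"
      by blast
    have "Q = P" if Q: "primeideal Q mpoly_ring" "?I \<subseteq> Q" "Q \<subseteq> P" for Q
    proof -
      have "{x. mvar x \<in> Q} \<subseteq> C" using Q(3) mvar_in_weight_ideal[of _ C] C(1) by blast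
      then have "{x. mvar x \<in> Q} = C" using below(1)[OF Q(1,2)] min by blast
      then show ?thesis using below(2)[OF Q(1,2)] Q(3) C(1) by auto
    qed
    then show "P \<in> ?L"
      using C primeideal_weight_ideal W_iff by (auto simp: minimal_primes_def)
  qed
qed

lemma covers_minimal:
  fixes H :: "'x::finite list set"
  assumes "covers H C"
  obtains D where "D \<subseteq> C" "covers H D" "\<And>D'. covers H D' \<Longrightarrow> D' \<subseteq> D \<Longrightarrow> D' = D"
proof -
  have "\<exists>D\<in>{D. covers H D}. D \<subseteq> C \<and> (\<forall>D'\<in>{D. covers H D}. D' \<subseteq> D \<longrightarrow> D = D')"
    using assms by (intro finite_has_minimal2) auto
  then show thesis using that by blast
qed

text \<open>Weight is monotone in the cover and every cover contains a minimal one, so the condition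
  may range over all covers. Later arguments then need not check minimality.\<close>

lemma symbolic_power_monomial_ideal:
  fixes H :: "'x::finite list set"
  shows "symbolic_power (monomial_ideal H :: ('x, 'k::field) mpoly set) m
    = {f. \<forall>w\<in>Poly_Mapping.keys f. \<forall>C. covers H C \<longrightarrow> m \<le> monom_weight C w}"
    (is "_ = ?R")
proof -
  let ?min = "\<lambda>C. covers H C \<and> (\<forall>D. covers H D \<longrightarrow> D \<subseteq> C \<longrightarrow> D = C)"
  have "symbolic_power (monomial_ideal H :: ('x, 'k::field) mpoly set) m
    = (\<Inter>C\<in>Collect ?min. weight_ideal C m)"
    unfolding symbolic_power_def minimal_primes_monomial_ideal image_Collect[symmetric]
    unfolding image_image weight_ideal_power ..
  also have "\<dots> = ?R"
  proof (intro equalityI subsetI)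
    fix f :: "('x, 'k) mpoly" assume f: "f \<in> (\<Inter>C\<in>Collect ?min. weight_ideal C m)"
    have "m \<le> monom_weight C w" if w: "w \<in> Poly_Mapping.keys f" and C: "covers H C" for w C
    proof -
      obtain D where D: "D \<subseteq> C" "?min D" using covers_minimal[OF C] by metis
      then have "m \<le> monom_weight D w" using f w by (auto simp: weight_ideal_def)
      also have "\<dots> \<le> monom_weight C w" using D(1) by (intro sum_mono2) auto
      finally show ?thesis .
    qed
    then show "f \<in> ?R" by blast
  qed (auto simp: weight_ideal_def)
  finally show ?thesis .
qed


section \<open>The initial degree as an integer program\<close>

text \<open>Such \<open>w\<close> are the exponent vectors of the monomials in the
  \<open>m\<close>-th symbolic power.\<close>

definition feasible :: "'x list set \<Rightarrow> nat \<Rightarrow> ('x \<Rightarrow> nat) \<Rightarrow> bool" where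
  "feasible H m w \<longleftrightarrow> (\<forall>C. covers H C \<longrightarrow> m \<le> sum w C)"

definition cover_degree :: "'x list set \<Rightarrow> nat \<Rightarrow> nat" where
  "cover_degree H m = (LEAST d. \<exists>w. feasible H m w \<and> sum w UNIV = d)"

text \<open>Membership in the symbolic power is decided term by term, so a term of maximal degree of
  a member is itself a member of the same degree. Hence polynomials and monomials attain the same
  degrees.\<close>

lemma initial_degree_symbolic_power:
  fixes H :: "'x::finite list set"
  shows "initial_degree (symbolic_power (monomial_ideal H :: ('x, 'k::field) mpoly set) m)
    = cover_degree H m"
proof -
  have deg: "monom_degree w = sum (Poly_Mapping.lookup w) UNIV" for w :: "'x \<Rightarrow>\<^sub>0 nat"
    unfolding monom_degree_def by (intro sum.mono_neutral_left) (auto simp: in_keys_iff)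
  have "(\<exists>f\<in>symbolic_power (monomial_ideal H :: ('x, 'k) mpoly set) m. f \<noteq> 0 \<and> total_degree f = d)
    \<longleftrightarrow> (\<exists>w. feasible H m w \<and> sum w UNIV = d)" (is "?L \<longleftrightarrow> ?R") for d
  proof
    assume ?L
    then obtain f :: "('x, 'k) mpoly" where f: "f \<noteq> 0" "total_degree f = d"
      "\<And>w. w \<in> Poly_Mapping.keys f \<Longrightarrow> feasible H m (Poly_Mapping.lookup w)"
      by (auto simp: symbolic_power_monomial_ideal feasible_def)
    have "Poly_Mapping.keys f \<noteq> {}"
      using f(1) poly_mapping_sum_single[of f] by force
    then have "d \<in> monom_degree ` Poly_Mapping.keys f"
      using f(2) unfolding total_degree_def by (auto intro: Max_in)
    then show ?R using f(3) deg by auto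
  next
    assume ?R
    then obtain w where w: "feasible H m w" "sum w UNIV = d" by blast
    \<comment> \<open>With finitely many variables, every function is a valid exponent
      vector.\<close>
    let ?w = "Abs_poly_mapping w"
    have [simp]: "Poly_Mapping.lookup ?w = w" by simp
    let ?f = "Poly_Mapping.single ?w 1 :: ('x, 'k) mpoly"
    have "?f \<in> symbolic_power (monomial_ideal H) m"
      using w by (auto simp: symbolic_power_monomial_ideal feasible_def)
    moreover have "Poly_Mapping.keys ?f \<noteq> {}" by simp
    then have "?f \<noteq> 0" by (metis keys_zero)
    moreover have "total_degree ?f = d" using w by (simp add: total_degree_def deg)
    ultimately show ?L by blast
  qed
  then show ?thesis by (simp add: initial_degree_def cover_degree_def)
qed

section \<open>Attainment and subadditivity of the minimum\<close>

text \<open>A cover is nonempty as soon as there is a generator to hit. This guarantees that the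
  minimum \<open>cover_degree\<close> is attained.\<close>

lemma feasible_const:
  fixes H :: "'x::finite list set"
  assumes "H \<noteq> {}"
  shows "feasible H m (\<lambda>_. m)"
  unfolding feasible_def
proof (intro allI impI)
  fix C assume "covers H C"
  then have "C \<noteq> {}" using assms by (auto simp: covers_def)
  then have "card C > 0" by (simp add: card_gt_0_iff)
  then show "m \<le> (\<Sum>_\<in>C. m)" by simp
qed

lemma cover_degree_attained:
  fixes H :: "'x::finite list set"
  assumes "H \<noteq> {}"
  obtains w where "feasible H m w" "sum w UNIV = cover_degree H m"
  using LeastI_ex[of "\<lambda>d. \<exists>w. feasible H m w \<and> sum w UNIV = d"] feasible_const[OF assms] that
  unfolding cover_degree_def by blast

lemma cover_degree_le: "feasible H m w \<Longrightarrow> cover_degree H m \<le> sum w UNIV"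
  unfolding cover_degree_def by (rule Least_le) blast

text \<open>The sum of solutions for \<open>m\<close> and \<open>n\<close> is a solution for
  \<open>m + n\<close>.\<close>

lemma cover_degree_subadditive:
  fixes H :: "'x::finite list set"
  assumes "H \<noteq> {}"
  shows "cover_degree H (m + n) \<le> cover_degree H m + cover_degree H n"
proof -
  obtain v w where "feasible H m v" "sum v UNIV = cover_degree H m"
    "feasible H n w" "sum w UNIV = cover_degree H n"
    using cover_degree_attained[OF assms] by metis
  then show ?thesis
    using cover_degree_le[of H "m + n" "\<lambda>x. v x + w x"]
    by (auto simp: feasible_def sum.distrib intro: add_mono)
qed

text \<open>Subadditivity yields convergence, so the \<open>lim\<close> in the definition is a
  genuine limit.\<close>

lemma waldschmidt_monomial_ideal:
  fixes H :: "'x::finite list set"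
  assumes "H \<noteq> {}"
  shows "(\<lambda>m. real (cover_degree H m) / real m)
    \<longlonglongrightarrow> waldschmidt (monomial_ideal H :: ('x, 'k::field) mpoly set)"
proof -
  have "cover_degree H 0 = 0"
    using cover_degree_le[of H 0 "\<lambda>_. 0"] by (simp add: feasible_def)
  moreover have "real (cover_degree H (m + n)) \<le> real (cover_degree H m) + real (cover_degree H n)" for m n
    using cover_degree_subadditive[OF assms, of m n] by linarith
  ultimately have "convergent (\<lambda>m. real (cover_degree H m) / real m)"
    by (intro subadditive_div_convergent) auto
  then show ?thesis
    by (simp add: waldschmidt_def initial_degree_symbolic_power convergent_LIMSEQ_iff)
qed


section \<open>Edge ideals and generic initial ideals\<close>

lemma UNIV_xy: "UNIV = range XVar \<union> range YVar"
proof -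
  have "x \<in> range XVar \<union> range YVar" for x :: "'a xy" by (cases x) auto
  then show ?thesis by blast
qed

instance xy :: (finite) finite
  by standard (simp add: UNIV_xy)

definition edge_lists :: "'v set set \<Rightarrow> 'v xy list set" where
  "edge_lists E = {[XVar a, XVar b] | a b. {a, b} \<in> E}"

definition path_lists :: "'v set set \<Rightarrow> 'v xy list set" where
  "path_lists E = {map YVar vs @ [XVar i, XVar j] | i vs j. graph_path E (i # vs @ [j])}"

lemma edge_ideal_eq: "edge_ideal E = monomial_ideal (edge_lists E)"
  unfolding edge_ideal_def monomial_ideal_def edge_lists_def
  by (rule arg_cong[where f = "genideal mpoly_ring"]) (force simp: image_iff)

lemma gin_binomial_edge_ideal_eq:
  "gin_binomial_edge_ideal E = (monomial_ideal (path_lists E) :: ('v::finite xy, 'k::field) mpoly set)"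
proof -
  have "(\<Prod>v\<leftarrow>vs. mvar (YVar v)) * mvar (XVar i) * mvar (XVar j)
    = (\<Prod>x\<leftarrow>map YVar vs @ [XVar i, XVar j]. mvar x :: ('v xy, 'k) mpoly)" for i j vs
    by (simp add: mult.assoc o_def)
  then show ?thesis
    unfolding gin_binomial_edge_ideal_def monomial_ideal_def path_lists_def
    by (intro arg_cong[where f = "genideal mpoly_ring"]) (simp only: image_def, blast)
qed

section \<open>Comparison of edges and paths\<close>

lemma simple_graph_edge_neq: "simple_graph E \<Longrightarrow> {a, b} \<in> E \<Longrightarrow> a \<noteq> b"
  by (auto simp: simple_graph_def)

lemma simple_graph_obtain_edge:
  assumes "simple_graph E" "E \<noteq> {}"
  obtains a b where "{a, b} \<in> E" "a \<noteq> b"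
proof -
  obtain e where "e \<in> E" "card e = 2" using assms by (auto simp: simple_graph_def)
  then show thesis using that by (auto simp: card_2_iff)
qed

text \<open>An edge is a path without inner vertices; its ends are distinct because the graph has no
  loops.\<close>

lemma edge_lists_subset_path_lists:
  assumes "simple_graph E"
  shows "edge_lists E \<subseteq> path_lists E"
proof
  fix xs assume "xs \<in> edge_lists E"
  then obtain a b where "xs = map YVar [] @ [XVar a, XVar b]" "{a, b} \<in> E"
    by (auto simp: edge_lists_def)
  moreover from this have "graph_path E (a # [] @ [b])"
    using simple_graph_edge_neq[OF assms] by (auto simp: graph_path_def)
  ultimately show "xs \<in> path_lists E" unfolding path_lists_def by blast
qed

lemma covers_edge_lists_iff:
  "covers (edge_lists E) C \<longleftrightarrow> (\<forall>a b. {a, b} \<in> E \<longrightarrow> XVar a \<in> C \<or> XVar b \<in> C)"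
proof -
  have "covers (edge_lists E) C \<longleftrightarrow> (\<forall>a b. {a, b} \<in> E \<longrightarrow> set [XVar a, XVar b] \<inter> C \<noteq> {})"
    unfolding covers_def edge_lists_def by blast
  then show ?thesis by simp
qed

text \<open>The first edge of a path has an end in \<open>A\<close>. Whether this vertex is an end
  or an inner vertex of the path, its variable in the generator lies in the doubled set.\<close>

lemma covers_path_lists:
  assumes "covers (edge_lists E) C"
  defines "A \<equiv> {v. XVar v \<in> C}"
  shows "covers (path_lists E) (XVar ` A \<union> YVar ` A)"
  unfolding covers_def
proof
  fix xs assume "xs \<in> path_lists E"
  then obtain i vs j where xs: "xs = map YVar vs @ [XVar i, XVar j]"
    and path: "graph_path E (i # vs @ [j])"
    by (auto simp: path_lists_def)
  \<comment> \<open>The second vertex of the path, which is \<open>j\<close> if there are no inner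
    vertices.\<close>
  define k where "k = hd (vs @ [j])"
  have "{i, k} \<in> E" using path by (cases vs) (auto simp: graph_path_def k_def)
  then have "i \<in> A \<or> k \<in> A"
    using assms(1) by (auto simp: covers_edge_lists_iff A_def)
  moreover have "k = j \<or> k \<in> set vs" by (cases vs) (auto simp: k_def)
  ultimately show "set xs \<inter> (XVar ` A \<union> YVar ` A) \<noteq> {}"
    by (auto simp: xs)
qed

lemma sum_XVar_YVar:
  fixes A :: "'v::finite set"
  shows "sum w (XVar ` A \<union> YVar ` A) = (\<Sum>v\<in>A. w (XVar v) + w (YVar v))"
  by (subst sum.union_disjoint) (auto simp: sum.reindex inj_on_def sum.distrib)

text \<open>Both programs attain the same total weights. From paths to edges the weights are merged;
  from edges to paths the same \<open>w\<close> works, since a cover of the paths also covers the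
  edges.\<close>

lemma cover_degree_path_lists:
  assumes "simple_graph (E :: 'v::finite set set)"
  shows "cover_degree (path_lists E) m = cover_degree (edge_lists E) m"
proof -
  have "(\<exists>w. feasible (path_lists E) m w \<and> sum w UNIV = d)
    \<longleftrightarrow> (\<exists>w. feasible (edge_lists E) m w \<and> sum w UNIV = d)" (is "?L \<longleftrightarrow> ?R") for d
  proof
    assume ?L
    then obtain w where w: "feasible (path_lists E) m w" "sum w UNIV = d" by blast
    define w' where "w' = (\<lambda>x. case x of XVar v \<Rightarrow> w (XVar v) + w (YVar v) | YVar v \<Rightarrow> 0)"
    have "feasible (edge_lists E) m w'"
      unfolding feasible_def
    proof (intro allI impI)
      fix C assume C: "covers (edge_lists E) C"
      let ?A = "{v. XVar v \<in> C}"
      have "m \<le> sum w (XVar ` ?A \<union> YVar ` ?A)"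
        using w(1) covers_path_lists[OF C] by (auto simp: feasible_def)
      also have "\<dots> = sum w' (XVar ` ?A)"
        by (simp add: sum_XVar_YVar sum.reindex inj_on_def w'_def)
      also have "\<dots> \<le> sum w' C" by (intro sum_mono2) auto
      finally show "m \<le> sum w' C" .
    qed
    moreover have "sum w' UNIV = d"
      using w(2) by (simp add: UNIV_xy sum_XVar_YVar w'_def)
    ultimately show ?R by blast
  next
    assume ?R
    moreover have "covers (edge_lists E) C" if "covers (path_lists E) C" for C
      using that edge_lists_subset_path_lists[OF assms] by (auto simp: covers_def)
    ultimately show ?L unfolding feasible_def by blast
  qed
  then show ?thesis by (simp add: cover_degree_def)
qed

section \<open>Colourings and the lower bound\<close>

text \<open>An injective numbering of the vertices is a proper colouring, so the minimum is over a
  nonempty set and is attained.\<close>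

lemma chromatic_number_colouring:
  fixes E :: "'v::finite set set"
  assumes "simple_graph E"
  obtains c where "\<And>v. c v < chromatic_number E" "proper_colouring E c"
proof -
  obtain c :: "'v \<Rightarrow> nat" where c: "inj c"
    using finite_imp_inj_to_nat_seg[OF finite[of "UNIV :: 'v set"]] by blast
  have "c v < Suc (Max (range c))" for v by (simp add: less_Suc_eq_le)
  moreover have "proper_colouring E c"
    using simple_graph_edge_neq[OF assms] injD[OF c] by (auto simp: proper_colouring_def)
  ultimately have "\<exists>k. \<exists>c. (\<forall>v. c v < k) \<and> proper_colouring E c" by blast
  from LeastI_ex[OF this] show thesis
    using that unfolding chromatic_number_def by blast
qed

lemma chromatic_number_ge_2:
  assumes "simple_graph E" "E \<noteq> {}"
  shows "chromatic_number E \<ge> 2"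
proof -
  obtain c where c: "\<And>v. c v < chromatic_number E" "proper_colouring E c"
    using chromatic_number_colouring[OF assms(1)] by blast
  obtain a b where "{a, b} \<in> E" using simple_graph_obtain_edge[OF assms] by blast
  then have "c a \<noteq> c b" using c(2) by (auto simp: proper_colouring_def)
  then show ?thesis using c(1)[of a] c(1)[of b] by linarith
qed

text \<open>
  Each colour class is independent, so its complement is a vertex cover; every vertex lies in
  all but one of these covers.
\<close>

lemma chromatic_number_mult_le:
  fixes E :: "'v::finite set set"
  assumes "simple_graph E" "feasible (edge_lists E) m w"
  shows "chromatic_number E * m \<le> (chromatic_number E - 1) * sum w UNIV"
proof -
  let ?k = "chromatic_number E"
  obtain c where c: "\<And>v. c v < ?k" "proper_colouring E c"
    using chromatic_number_colouring[OF assms(1)] by blast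
  have "m \<le> (\<Sum>v | c v \<noteq> i. w (XVar v))" for i
  proof -
    have "covers (edge_lists E) (XVar ` {v. c v \<noteq> i})"
      using c(2) by (auto simp: covers_edge_lists_iff proper_colouring_def)
    then have "m \<le> sum w (XVar ` {v. c v \<noteq> i})" using assms(2) by (simp add: feasible_def)
    then show ?thesis by (simp add: sum.reindex inj_on_def)
  qed
  then have "(\<Sum>i<?k. m) \<le> (\<Sum>i<?k. \<Sum>v | c v \<noteq> i. w (XVar v))" by (intro sum_mono)
  \<comment> \<open>Double counting: the sum over colours and the vertices outside each class is
    rearranged by vertices.\<close>
  also have "\<dots> = (\<Sum>v\<in>UNIV. \<Sum>i | i < ?k \<and> c v \<noteq> i. w (XVar v))"
    using sum.swap_restrict[of "{..<?k}" "UNIV :: 'v set" "\<lambda>i v. w (XVar v)" "\<lambda>i v. c v \<noteq> i"]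
    by simp
  also have "\<dots> = (\<Sum>v\<in>UNIV. (?k - 1) * w (XVar v))"
  proof (rule sum.cong)
    fix v
    have "{i. i < ?k \<and> c v \<noteq> i} = {..<?k} - {c v}" by auto
    then show "(\<Sum>i | i < ?k \<and> c v \<noteq> i. w (XVar v)) = (?k - 1) * w (XVar v)"
      using c(1)[of v] by simp
  qed simp
  also have "\<dots> = (?k - 1) * sum w (range XVar)"
    by (simp add: sum_distrib_left sum.reindex inj_on_def)
  also have "\<dots> \<le> (?k - 1) * sum w UNIV"
    by (intro mult_left_mono sum_mono2) auto
  finally show ?thesis by simp
qed

section \<open>Cliques and the upper bound\<close>

lemma clique_number_attained:
  fixes E :: "'v::finite set set"
  obtains K where "clique E K" "card K = clique_number E"
proof -
  have "card ({} :: 'v set) \<in> {card C | C. clique E C}" by (force simp: clique_def)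
  moreover have fin: "finite {card C | C. clique E C}" by simp
  ultimately have "clique_number E \<in> {card C | C. clique E C}"
    unfolding clique_number_def by (intro Max_in) auto
  then show thesis using that by auto
qed

lemma clique_number_ge_2:
  fixes E :: "'v::finite set set"
  assumes "simple_graph E" "E \<noteq> {}"
  shows "clique_number E \<ge> 2"
proof -
  obtain a b where ab: "{a, b} \<in> E" "a \<noteq> b" using simple_graph_obtain_edge[OF assms] by blast
  then have "clique E {a, b}" by (auto simp: clique_def insert_commute)
  then have "card {a, b} \<in> {card C | C. clique E C}" by blast
  moreover have "finite {card C | C. clique E C}" by simp
  ultimately have "card {a, b} \<le> clique_number E"
    unfolding clique_number_def by (intro Max_ge)
  then show ?thesis using ab by simp
qed

text \<open>Each vertex of \<open>K\<close> gets weight \<open>t\<close>. A vertex cover misses at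
  most one vertex of \<open>K\<close>, since two missed vertices would span an uncovered
  edge.\<close>

lemma cover_degree_clique:
  fixes E :: "'v::finite set set"
  assumes "clique E K"
  shows "cover_degree (edge_lists E) (t * (card K - 1)) \<le> t * card K"
proof -
  define w where "w = (\<lambda>x. if x \<in> XVar ` K then t else 0)"
  have sum_w: "sum w C = t * card {v\<in>K. XVar v \<in> C}" for C
  proof -
    have "sum w C = t * card (C \<inter> XVar ` K)" by (simp add: w_def sum.If_cases)
    also have "C \<inter> XVar ` K = XVar ` {v\<in>K. XVar v \<in> C}" by auto
    finally show ?thesis by (simp add: card_image inj_on_def)
  qed
  have "t * (card K - 1) \<le> sum w C" if C: "covers (edge_lists E) C" for C
  proof -
    let ?A = "{v\<in>K. XVar v \<in> C}"
    have "card (K - ?A) \<le> 1"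
    proof (rule ccontr)
      assume "\<not> ?thesis"
      then obtain u v where uv: "u \<in> K" "v \<in> K" "XVar u \<notin> C" "XVar v \<notin> C" "u \<noteq> v"
        by (auto simp: not_le card_le_Suc0_iff_eq)
      then have "{u, v} \<in> E" using assms by (auto simp: clique_def)
      then show False using C uv by (auto simp: covers_edge_lists_iff)
    qed
    moreover have "card (K - ?A) = card K - card ?A" by (intro card_Diff_subset) auto
    ultimately show ?thesis unfolding sum_w by (intro mult_le_mono2) simp
  qed
  then have "feasible (edge_lists E) (t * (card K - 1)) w" by (simp add: feasible_def)
  from cover_degree_le[OF this] show ?thesis by (simp add: sum_w)
qed

theorem theorem3:
  fixes E :: "'v::finite set set"
  assumes "simple_graph E" and "E \<noteq> {}"
  shows "real (chromatic_number E) / (real (chromatic_number E) - 1)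
           \<le> waldschmidt (gin_binomial_edge_ideal E :: ('v xy, 'k::field) mpoly set)
       \<and> waldschmidt (gin_binomial_edge_ideal E :: ('v xy, 'k) mpoly set)
           = waldschmidt (edge_ideal E :: ('v xy, 'k) mpoly set)
       \<and> waldschmidt (edge_ideal E :: ('v xy, 'k) mpoly set)
           \<le> real (clique_number E) / (real (clique_number E) - 1)"
proof -
  let ?L = "waldschmidt (edge_ideal E :: ('v xy, 'k) mpoly set)"
  let ?d = "cover_degree (edge_lists E)"
  let ?k = "chromatic_number E"
  obtain a b where "{a, b} \<in> E" by (rule simple_graph_obtain_edge[OF assms])
  then have ne: "edge_lists E \<noteq> {}" by (auto simp: edge_lists_def)
  have lim: "(\<lambda>m. real (?d m) / real m) \<longlonglongrightarrow> ?L"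
    unfolding edge_ideal_eq by (rule waldschmidt_monomial_ideal[OF ne])
  \<comment> \<open>The two sequences of initial degrees agree for every \<open>m\<close>, so the
    equality holds before any limit is taken.\<close>
  have eq: "waldschmidt (gin_binomial_edge_ideal E :: ('v xy, 'k) mpoly set) = ?L"
    by (simp add: waldschmidt_def gin_binomial_edge_ideal_eq edge_ideal_eq
        initial_degree_symbolic_power cover_degree_path_lists[OF assms(1)])
  have "real ?k / (real ?k - 1) \<le> real (?d m) / real m" if "m \<ge> 1" for m
  proof -
    obtain w where w: "feasible (edge_lists E) m w" "sum w UNIV = ?d m"
      using cover_degree_attained[OF ne] by blast
    have k: "?k \<ge> 2" by (rule chromatic_number_ge_2[OF assms])
    have "real (?k * m) \<le> real ((?k - 1) * ?d m)"
      using chromatic_number_mult_le[OF assms(1) w(1)] w(2) of_nat_le_iff by metis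
    then have "real ?k * real m \<le> (real ?k - 1) * real (?d m)"
      using k by (simp add: of_nat_diff)
    then show ?thesis using k that by (simp add: field_simps)
  qed
  then have lower: "real ?k / (real ?k - 1) \<le> ?L"
    using LIMSEQ_le_const[OF lim] by blast
  obtain K where K: "clique E K" "card K = clique_number E" by (rule clique_number_attained)
  define q where "q = card K - 1"
  have q: "q \<ge> 1" "card K = Suc q"
    using clique_number_ge_2[OF assms] K(2) by (auto simp: q_def)
  \<comment> \<open>The clique bound concerns only multiples of \<open>q\<close>; since the whole
    sequence converges, this subsequence has the same limit.\<close>
  have "strict_mono (\<lambda>t. t * q)" using q by (intro strict_monoI) auto
  from LIMSEQ_subseq_LIMSEQ[OF lim this]
  have "(\<lambda>t. real (?d (t * q)) / real (t * q)) \<longlonglongrightarrow> ?L" by (simp add: o_def)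
  moreover have "real (?d (t * q)) / real (t * q) \<le> real (card K) / real q" if "t \<ge> 1" for t
  proof -
    have "real (?d (t * q)) \<le> real (t * card K)"
      using cover_degree_clique[OF K(1), of t] unfolding q_def by (simp only: of_nat_le_iff)
    then show ?thesis using that q(1) by (simp add: field_simps)
  qed
  ultimately have "?L \<le> real (card K) / real q"
    using LIMSEQ_le_const2 by blast
  moreover have "real q = real (clique_number E) - 1" using q K(2) by simp
  ultimately show ?thesis using lower eq K(2) by simp
qed

end
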